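(* Let $l\ge1$ and let $\mathbf{s}=(s_1,\ldots,s_l)\in\mathbb{N}^l$ with $s_1\ge s_2\ge\cdots\ge s_l$. Let $\mathcal{F}\subset\mathrm{Symb}(\mathbf{s})$ be a family of symbols, and let $S_{\mathcal{F}}\in\mathcal{F}$ be the symbol constructed greedily from $\mathcal{F}$ as in the context. Then $b(S_{\mathcal{F}})\le b(S)$ for all $S\in\mathcal{F}$, with equality if and only if $S=S_{\mathcal{F}}$.
   Context: **Symbols.** An $l$-symbol $S\in\mathrm{Symb}(\mathbf{s})$ of multicharge $\mathbf{s}$ consists of $l$ rows, the $i$-th row being a strictly increasing sequence $\beta^i_1<\beta^i_2<\cdots<\beta^i_{s_i}$ of $s_i$ non-negative integers. The rows are displayed from top (row $1$) to bottom (row $l$), right-aligned, so that the last entries $\beta^1_{s_1},\dots,\beta^l_{s_l}$ lie in the same (rightmost) column. **The statistic $b$.** $$b(S)=\sum_{i=1}^{l}\sum_{j=1}^{s_i}\big(l(s_i-j)+i-1\big)\big(\beta^i_j-j+1\big).$$ (When $s_l\ge n$ and $S$ corresponds to the $l$-partition of $n$ with $\lambda^{(i)}_{s_i-j+1}=\beta^i_j-j+1$, this is the $b$-invariant, i.e. the valuation of the fake degree, of the irreducible character of $G(l,1,n)$ parametrized by $S$.) **Families.** Two symbols $S,T\in\mathrm{Symb}(\mathbf{s})$ belong to the same (Calogero--Moser) family if their multisets of entries (all rows together, with multiplicity) are equal. This partitions $\mathrm{Symb}(\mathbf{s})$ into families. **The sequence $z(S)$.** $z(S)$ is the sequence of length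 $s_1+\cdots+s_l$ obtained by reading the entries of the right-aligned display of $S$ column by column from left to right, each column being read from bottom to top. (E.g. for $\mathbf{s}=(5,5,3)$ and rows $(0,1,2,8,12)$, $(0,1,2,7,11)$, $(0,5,9)$, one has $z(S)=(0,0,1,1,0,2,2,5,7,8,9,11,12)$.) A symbol is determined by $z(S)$. **The symbol $S_{\mathcal{F}}$.** Let $\mathcal{F}$ be a family with underlying multiset of entries $\mathcal{E}$. The symbol $S_{\mathcal{F}}\in\mathcal{F}$ is defined through its sequence $z(S_{\mathcal{F}})$: (1) $z(S_{\mathcal{F}})_1=\min\mathcal{E}$; (2) once $z(S_{\mathcal{F}})_1,\ldots,z(S_{\mathcal{F}})_i$ are defined, $z(S_{\mathcal{F}})_{i+1}$ is the minimal element $x$ of the multiset difference $\mathcal{E}\setminus\{z(S_{\mathcal{F}})_1,\ldots,z(S_{\mathcal{F}})_i\}$ such that there exists a symbol $S\in\mathcal{F}$ whose sequence $z(S)$ starts with $(z(S_{\mathcal{F}})_1,\ldots,z(S_{\mathcal{F}})_i,x)$. *)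

theory Defs
  imports Complex_Main "HOL-Library.Multiset" "HOL-Library.Sublist"
begin

text \<open>A multicharge is a list \<open>s = [s\<^sub>1, \<dots>, s\<^sub>l]\<close>; a symbol is the list of its rows, top row first.
  Lists are indexed from 0, so the entry \<open>\<beta>\<close> in row \<open>i\<close> at place \<open>j\<close> (both counted from 1)
  is \<open>S ! (i - 1) ! (j - 1)\<close>.\<close>

definition Symb :: "nat list \<Rightarrow> nat list list set" where
  "Symb s = {S. map length S = s \<and> (\<forall>row\<in>set S. sorted_wrt (<) row)}"

text \<open>The first factor below is a natural number (\<open>j \<le> s\<^sub>i\<close> and \<open>i \<ge> 1\<close>, so nothing is truncated);
  the second one is computed in the integers.\<close>

definition b_stat :: "nat list list \<Rightarrow> int" where
  "b_stat S = (\<Sum>i = 1..length S. \<Sum>j = 1..length (S ! (i - 1)).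
      int (length S * (length (S ! (i - 1)) - j) + i - 1) *
      (int (S ! (i - 1) ! (j - 1)) - int j + 1))"

definition entries :: "nat list list \<Rightarrow> nat multiset" where
  "entries S = mset (concat S)"

definition family_rel :: "nat list \<Rightarrow> (nat list list \<times> nat list list) set" where
  "family_rel s = {(S, T). S \<in> Symb s \<and> T \<in> Symb s \<and> entries S = entries T}"

definition families :: "nat list \<Rightarrow> nat list list set set" where
  "families s = Symb s // family_rel s"

definition num_columns :: "nat list list \<Rightarrow> nat" where
  "num_columns S = Max (length ` set S)"

text \<open>Column \<open>c\<close> (counted from 0 at the left) of the right-aligned display, read from bottom to top.
  A row of length \<open>k\<close> occupies the columns from \<open>num_columns S - k\<close> on.\<close>

definition column :: "nat list list \<Rightarrow> nat \<Rightarrow> nat list" where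
  "column S c =
     [row ! (c - (num_columns S - length row)). row \<leftarrow> rev S, num_columns S - length row \<le> c]"

definition z_seq :: "nat list list \<Rightarrow> nat list" where
  "z_seq S = concat (map (column S) [0..<num_columns S])"

lemma z_seq_example:
  "z_seq [[0,1,2,8,12], [0,1,2,7,11], [0,5,9]] = [0,0,1,1,0,2,2,5,7,8,9,11,12]"
  by (simp add: z_seq_def column_def num_columns_def upt_rec)

definition family_entries :: "nat list list set \<Rightarrow> nat multiset" where
  "family_entries F = (THE E. \<forall>S\<in>F. entries S = E)"

text \<open>\<open>greedy_prefix F i\<close> consists of the first \<open>i\<close> terms of the greedily chosen sequence.\<close>

primrec greedy_prefix :: "nat list list set \<Rightarrow> nat \<Rightarrow> nat list" where
  "greedy_prefix F 0 = []"
| "greedy_prefix F (Suc i) = greedy_prefix F i @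
     [if i = 0 then Min (set_mset (family_entries F))
      else LEAST x. x \<in># family_entries F - mset (greedy_prefix F i) \<and>
             (\<exists>S\<in>F. prefix (greedy_prefix F i @ [x]) (z_seq S))]"

definition S_fam :: "nat list list set \<Rightarrow> nat list list" where
  "S_fam F = (THE S. S \<in> F \<and> z_seq S = greedy_prefix F (size (family_entries F)))"

end

theory Submission
  imports Defs
begin

text \<open>
  Number the cell in row \<open>i\<close> (counted from 0) at distance \<open>d\<close> from the right end by \<open>w = l * d + i\<close>.
  Then \<open>z_seq S\<close> lists the entries by decreasing \<open>w\<close>, up to a constant \<open>b_stat S\<close> is the sum of
  \<open>w\<close> times the entry in cell \<open>w\<close>, and the rows increase iff the entry in cell \<open>w + l\<close> is always
  smaller than the one in cell \<open>w\<close>.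

  Consider the set \<open>X\<^sub>v\<close> of cells with entry at least \<open>v\<close>; passing from \<open>X\<^sub>v\<close> to \<open>X\<^sub>v\<^sub>+\<^sub>1\<close> removes
  \<open>m\<^sub>v\<close> cells \<open>w \<in> X\<^sub>v\<close> with \<open>w + l \<notin> X\<^sub>v\<close>, where \<open>m\<^sub>v\<close> is the multiplicity of \<open>v\<close>. Always removing
  the \<open>m\<^sub>v\<close> largest such cells minimises the number of cells \<open>w \<ge> t\<close> in \<open>X\<^sub>v\<close> for all \<open>t\<close> and \<open>v\<close>
  simultaneously. The resulting symbol therefore is the unique minimum of \<open>b_stat\<close> (a double sum of these
  numbers), and its \<open>z_seq\<close> is lexicographically minimal, so it is the greedily built symbol.
\<close>

section \<open>Sets of cells closed towards the right end of each row, and their tail counts\<close>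

definition closed_under_sub :: "nat \<Rightarrow> nat set \<Rightarrow> bool" where
  "closed_under_sub l X \<longleftrightarrow> (\<forall>w. w + l \<in> X \<longrightarrow> w \<in> X)"

text \<open>For a closed \<open>X\<close> and positive \<open>l\<close> these are the leftmost cells
  of \<open>X\<close> in each row: in the level set of a value \<open>v\<close>, the only cells that
  can carry \<open>v\<close> itself.\<close>

definition ends :: "nat \<Rightarrow> nat set \<Rightarrow> nat set" where
  "ends l X = {w \<in> X. w + l \<notin> X}"

definition tail_card :: "nat set \<Rightarrow> nat \<Rightarrow> nat" where
  "tail_card X t = card {w \<in> X. t \<le> w}"

text \<open>The \<open>m\<close> largest elements of a finite \<open>A\<close>, or all of
  \<open>A\<close> if it has fewer. Selecting by rank keeps this compatible with discarding small
  elements.\<close>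

definition top_part :: "nat \<Rightarrow> nat set \<Rightarrow> nat set" where
  "top_part m A = {a \<in> A. card {b \<in> A. a < b} < m}"

lemma top_part_subset: "top_part m A \<subseteq> A"
  by (auto simp: top_part_def)

text \<open>Insert a new minimum: the ranks of the old elements do not change, and the new element
  has \<open>card A\<close> elements above it.\<close>

lemma card_top_part:
  assumes "finite A"
  shows "card (top_part m A) = min m (card A)"
  using assms
proof (induction A rule: finite_linorder_min_induct)
  case empty
  then show ?case by (simp add: top_part_def)
next
  case (insert b A)
  have b: "b \<notin> A" using insert by auto
  have *: "{c \<in> insert b A. b < c} = A" "\<And>a. a \<in> A \<Longrightarrow> {c \<in> insert b A. a < c} = {c \<in> A. a < c}"
    using insert by auto
  have "a \<in> top_part m (insert b A) \<longleftrightarrow>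
      a \<in> top_part m A \<union> (if card A < m then {b} else {})" for a
  proof (cases "a = b")
    case True
    show ?thesis unfolding True top_part_def mem_Collect_eq *(1) using b by simp
  next
    case False
    then show ?thesis unfolding top_part_def mem_Collect_eq using *(2)[of a]
      by (cases "a \<in> A") simp_all
  qed
  then have "top_part m (insert b A) = top_part m A \<union> (if card A < m then {b} else {})"
    by blast
  moreover have "b \<notin> top_part m A" "finite (top_part m A)"
    using b insert finite_subset[OF top_part_subset] by (auto simp: top_part_def)
  ultimately show ?case using insert b by auto
qed

text \<open>The rank of an element \<ge> \<open>t\<close> involves larger elements only, so cutting
  off below \<open>t\<close> commutes with taking the top part.\<close>

lemma tail_card_top_part:
  assumes "finite A"
  shows "tail_card (top_part m A) t = min m (tail_card A t)"
proof -
  let ?A = "{a \<in> A. t \<le> a}"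
  have "{b \<in> ?A. a < b} = {b \<in> A. a < b}" if "t \<le> a" for a
    using that by auto
  then have "a \<in> {a \<in> top_part m A. t \<le> a} \<longleftrightarrow> a \<in> top_part m ?A" for a
    unfolding top_part_def mem_Collect_eq by (cases "t \<le> a") simp_all
  then have "{a \<in> top_part m A. t \<le> a} = top_part m ?A"
    by blast
  then show ?thesis unfolding tail_card_def using assms by (simp add: card_top_part)
qed

lemma tail_card_0 [simp]: "tail_card X 0 = card X"
  by (simp add: tail_card_def)

lemma tail_card_mono: "finite Y \<Longrightarrow> X \<subseteq> Y \<Longrightarrow> tail_card X t \<le> tail_card Y t"
  unfolding tail_card_def by (rule card_mono) auto

lemma tail_card_le_card: "finite X \<Longrightarrow> tail_card X t \<le> card X"
  unfolding tail_card_def by (rule card_mono) auto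

lemma tail_card_Diff:
  assumes "finite X" "B \<subseteq> X"
  shows "tail_card X t = tail_card (X - B) t + tail_card B t"
proof -
  have "{w \<in> X. t \<le> w} = {w \<in> X - B. t \<le> w} \<union> {w \<in> B. t \<le> w}" using assms by auto
  then show ?thesis unfolding tail_card_def
    by (simp add: card_Un_disjoint assms finite_subset[OF assms(2,1)] disjoint_iff)
qed

lemma ends_subset: "ends l X \<subseteq> X"
  by (auto simp: ends_def)

text \<open>A cell of \<open>X\<close> that is not an end has its left neighbour in
  \<open>X\<close>, so adding \<open>l\<close> sends the non-ends \<ge> \<open>t\<close> into the
  cells \<ge> \<open>t + l\<close>; closure makes this map onto.\<close>

lemma tail_card_shift:
  assumes "finite X" "closed_under_sub l X"
  shows "tail_card X t = tail_card X (t + l) + tail_card (ends l X) t"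
proof -
  have "bij_betw (\<lambda>w. w + l) {w \<in> X - ends l X. t \<le> w} {w \<in> X. t + l \<le> w}"
  proof (rule bij_betw_imageI)
    show "(\<lambda>w. w + l) ` {w \<in> X - ends l X. t \<le> w} = {w \<in> X. t + l \<le> w}" (is "?L = ?R")
    proof
      show "?L \<subseteq> ?R" by (auto simp: ends_def)
      show "?R \<subseteq> ?L"
      proof
        fix w assume w: "w \<in> ?R"
        then obtain u where u: "w = u + l" by (metis (no_types, lifting) add.commute add_leD2 le_add_diff_inverse mem_Collect_eq)
        then have "u \<in> {w \<in> X - ends l X. t \<le> w}"
          using w assms by (auto simp: ends_def closed_under_sub_def)
        then show "w \<in> ?L" using u by auto
      qed
    qed
  qed (auto simp: inj_on_def)
  then have "tail_card (X - ends l X) t = tail_card X (t + l)"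
    unfolding tail_card_def by (rule bij_betw_same_card)
  then show ?thesis using tail_card_Diff[OF assms(1) ends_subset, of t l] by simp
qed

lemma closed_under_sub_Diff:
  assumes "closed_under_sub l X" "B \<subseteq> ends l X" shows "closed_under_sub l (X - B)"
  using assms by (auto simp: closed_under_sub_def ends_def)

text \<open>If at most \<open>card D\<close> ends of \<open>X\<close> are \<open>\<ge> t\<close>, all of them get removed, and by \<open>tail_card_shift\<close>
  what is left above \<open>t\<close> is counted by the hypothesis at \<open>t + l\<close>; otherwise exactly \<open>card D\<close>
  cells \<open>\<ge> t\<close> disappear from \<open>X\<close>, the most that \<open>Y\<close> can lose.\<close>

lemma greedy_step:
  assumes X: "finite X" "closed_under_sub l X" and Y: "finite Y" "closed_under_sub l Y"
    and dom: "\<And>t. tail_card X t \<le> tail_card Y t" and card: "card X = card Y"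
    and D: "D \<subseteq> ends l Y"
  defines "B \<equiv> top_part (card D) (ends l X)"
  shows "card B = card D" "tail_card (X - B) t \<le> tail_card (Y - D) t"
proof -
  have fin: "finite (ends l X)" "finite (ends l Y)" "finite D"
    using X Y D finite_subset[OF ends_subset] finite_subset by metis+
  have DY: "D \<subseteq> Y" using D ends_subset by blast
  have BX: "B \<subseteq> X" using top_part_subset ends_subset unfolding B_def by blast
  have B: "tail_card B t = min (card D) (tail_card (ends l X) t)" for t
    unfolding B_def by (rule tail_card_top_part[OF fin(1)])
  have D1: "tail_card D t \<le> card D" for t using fin(3) by (rule tail_card_le_card)
  have D2: "tail_card D t \<le> tail_card (ends l Y) t" for t
    by (rule tail_card_mono[OF fin(2) D])
  show le: "tail_card (X - B) t \<le> tail_card (Y - D) t" for t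
    using tail_card_Diff[OF X(1) BX, of t] tail_card_Diff[OF Y(1) DY, of t]
      tail_card_shift[OF X, of t] tail_card_shift[OF Y, of t] dom[of t] dom[of "t + l"]
      B[of t] D1[of t] D2[of t] by linarith
  \<comment> \<open>At \<open>t = 0\<close> the domination compares total sizes. As \<open>X\<close>
    and \<open>Y\<close> are equally large, \<open>B\<close> has at least \<open>card D\<close>
    elements, so \<open>X\<close> has enough ends.\<close>
  show "card B = card D"
    using le[of 0] tail_card_Diff[OF X(1) BX, of 0] tail_card_Diff[OF Y(1) DY, of 0] B[of 0] card
    unfolding tail_card_0 by linarith
qed

section \<open>Peeling off the cells value by value\<close>

primrec peel :: "nat \<Rightarrow> (nat \<Rightarrow> nat) \<Rightarrow> nat set \<Rightarrow> nat \<Rightarrow> nat set" where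
  "peel l m W 0 = W"
| "peel l m W (Suc v) = peel l m W v - top_part (m v) (ends l (peel l m W v))"

definition labelling :: "nat \<Rightarrow> nat set \<Rightarrow> (nat \<Rightarrow> nat) \<Rightarrow> bool" where
  "labelling l W f \<longleftrightarrow> (\<forall>w. w + l \<in> W \<longrightarrow> f (w + l) < f w)"

lemma closed_under_sub_level:
  assumes "closed_under_sub l W" "labelling l W f"
  shows "closed_under_sub l {w \<in> W. v \<le> f w}"
  using assms unfolding closed_under_sub_def labelling_def by fastforce

lemma peel_antimono: "u \<le> v \<Longrightarrow> peel l m W v \<subseteq> peel l m W u"
  by (induction v rule: dec_induct) auto

lemma peel_closed:
  assumes "closed_under_sub l W" shows "closed_under_sub l (peel l m W v)"
  by (induction v) (use assms in \<open>auto intro!: closed_under_sub_Diff top_part_subset\<close>)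

text \<open>Iterates \<open>greedy_step\<close>, carrying along the equality of sizes that this step
  requires. That some labelling \<open>f\<close> has multiplicities \<open>m\<close> ensures that
  peeling never runs short of ends.\<close>

lemma peel_dominated:
  assumes W: "finite W" "closed_under_sub l W" and f: "labelling l W f"
    and m: "\<And>v. card {w \<in> W. f w = v} = m v"
  shows "(\<forall>t. tail_card (peel l m W v) t \<le> tail_card {w \<in> W. v \<le> f w} t) \<and>
    card (peel l m W v) = card {w \<in> W. v \<le> f w}"
proof (induction v)
  case 0
  then show ?case by simp
next
  case (Suc v)
  let ?X = "peel l m W v" and ?Y = "{w \<in> W. v \<le> f w}" and ?D = "{w \<in> W. f w = v}"
  have X: "finite ?X" "closed_under_sub l ?X"
    using peel_antimono[of 0 v l m W] W finite_subset by (auto intro: peel_closed)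
  have Y: "finite ?Y" "closed_under_sub l ?Y"
    using W closed_under_sub_level[OF W(2) f] by auto
  \<comment> \<open>If \<open>w\<close> has label \<open>v\<close>, then \<open>w + l\<close> has a
    label below \<open>v\<close> or lies outside \<open>W\<close>.\<close>
  have D: "?D \<subseteq> ends l ?Y"
    using f by (fastforce simp: ends_def labelling_def)
  note step = greedy_step[OF X Y _ _ D, unfolded m]
  have YD: "?Y - ?D = {w \<in> W. Suc v \<le> f w}" by auto
  have 1: "card (top_part (m v) (ends l ?X)) = m v"
    and 2: "tail_card (peel l m W (Suc v)) t \<le> tail_card {w \<in> W. Suc v \<le> f w} t" for t
    using step Suc YD by auto
  have "top_part (m v) (ends l ?X) \<subseteq> ?X"
    using top_part_subset ends_subset by (rule subset_trans)
  then have "card (peel l m W (Suc v)) = card ?X - m v"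
    using 1 X(1) by (simp add: card_Diff_subset finite_subset)
  moreover have "card {w \<in> W. Suc v \<le> f w} = card ?Y - m v"
    using m[of v] Y(1) card_Diff_subset[of ?D ?Y] W(1) unfolding YD[symmetric] by fastforce
  ultimately show ?case using 2 Suc by auto
qed

text \<open>The stage at which \<open>w\<close> is removed, which becomes its entry in the greedy
  symbol.\<close>

definition peel_label :: "nat \<Rightarrow> (nat \<Rightarrow> nat) \<Rightarrow> nat set \<Rightarrow> nat \<Rightarrow> nat" where
  "peel_label l m W w = (LEAST v. w \<notin> peel l m W (Suc v))"

text \<open>Here \<open>f\<close> supplies the multiplicities and certifies that they can be
  realised. The bound at \<open>Max W\<close> serves the first greedy term, which is the plain
  minimum of all entries.\<close>

lemma greedy_labelling:
  assumes W: "finite W" "closed_under_sub l W" and l: "l > 0" and f: "labelling l W f"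
  obtains g where "labelling l W g" "\<And>v. card {w \<in> W. g w = v} = card {w \<in> W. f w = v}"
    "\<And>w. w \<in> W \<Longrightarrow> g (Max W) \<le> g w"
    "\<And>h v t. labelling l W h \<Longrightarrow> (\<And>v. card {w \<in> W. h w = v} = card {w \<in> W. f w = v}) \<Longrightarrow>
      tail_card {w \<in> W. v \<le> g w} t \<le> tail_card {w \<in> W. v \<le> h w} t"
proof
  define m where "m v = card {w \<in> W. f w = v}" for v
  let ?P = "peel l m W" and ?g = "peel_label l m W"
  have dom: "(\<forall>t. tail_card (?P v) t \<le> tail_card {w \<in> W. v \<le> h w} t) \<and>
    card (?P v) = card {w \<in> W. v \<le> h w}"
    if "labelling l W h" "\<And>v. card {w \<in> W. h w = v} = m v" for h v
    by (rule peel_dominated[OF W that])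
  have PW: "?P v \<subseteq> W" for v using peel_antimono[of 0 v l m W] by simp
  have finP: "finite (?P v)" for v using PW W finite_subset by blast
  have ex: "\<exists>v. w \<notin> ?P (Suc v)" for w
  proof -
    \<comment> \<open>Beyond the largest value of \<open>f\<close> its level sets are empty, so by
      equality of sizes the peeled set is empty too.\<close>
    obtain V where V: "\<And>w. w \<in> W \<Longrightarrow> f w \<le> V"
      using W(1) by (metis finite_imageI finite_nat_set_iff_bounded_le imageI)
    then have e: "{w \<in> W. Suc V \<le> f w} = {}" by fastforce
    have "card (?P (Suc V)) = card {w \<in> W. Suc V \<le> f w}"
      using dom[OF f m_def[symmetric], of "Suc V"] ..
    then have "card (?P (Suc V)) = 0" unfolding e by simp
    then show ?thesis using finP[of "Suc V"] by (metis card_0_eq empty_iff)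
  qed
  have lev: "v \<le> ?g w \<longleftrightarrow> w \<in> ?P v" if w: "w \<in> W" for v w
  proof
    assume v: "v \<le> ?g w"
    show "w \<in> ?P v"
    proof (cases v)
      case (Suc u)
      then show ?thesis using v not_less_Least[of u "\<lambda>v. w \<notin> ?P (Suc v)"] 
        by (auto simp: peel_label_def)
    qed (use w in simp)
  next
    assume "w \<in> ?P v"
    moreover have "w \<notin> ?P (Suc (?g w))" unfolding peel_label_def by (rule LeastI_ex[OF ex])
    ultimately show "v \<le> ?g w" using peel_antimono[of "Suc (?g w)" v l m W]
      by (meson not_less_eq_eq subsetD)
  qed
  have levS: "{w \<in> W. v \<le> ?g w} = ?P v" for v using lev PW by blast
  have gone: "w \<in> top_part (m (?g w)) (ends l (?P (?g w)))" if "w \<in> W" for w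
    using lev[OF that, of "Suc (?g w)"] lev[OF that, of "?g w"] by auto
  show "labelling l W ?g"
    unfolding labelling_def
  proof (intro allI impI)
    fix w assume w: "w + l \<in> W"
    then have "w \<in> W" using W by (auto simp: closed_under_sub_def)
    \<comment> \<open>When \<open>w\<close> is removed it is an end, so \<open>w + l\<close> is
      already gone.\<close>
    from gone[OF this] have "w + l \<notin> ?P (?g w)" by (auto simp: top_part_def ends_def)
    then show "?g (w + l) < ?g w" using lev[OF w] by (meson not_le)
  qed
  show "card {w \<in> W. ?g w = v} = card {w \<in> W. f w = v}" for v
  proof -
    \<comment> \<open>A fibre is the difference of two consecutive upper level sets, whose sizes
      agree for both labellings.\<close>
    have *: "card {w \<in> W. h w = v} = card {w \<in> W. v \<le> h w} - card {w \<in> W. Suc v \<le> h w}" for h :: "nat \<Rightarrow> nat"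
    proof -
      have "{w \<in> W. h w = v} = {w \<in> W. v \<le> h w} - {w \<in> W. Suc v \<le> h w}" by auto
      moreover have "{w \<in> W. Suc v \<le> h w} \<subseteq> {w \<in> W. v \<le> h w}" by auto
      ultimately show ?thesis using W(1) by (metis (no_types, lifting) card_Diff_subset finite_subset mem_Collect_eq subsetI)
    qed
    show ?thesis unfolding * levS using dom[OF f m_def[symmetric]] by metis
  qed
  show "?g (Max W) \<le> ?g w" if w: "w \<in> W" for w
  proof (rule ccontr)
    let ?v = "?g w"
    assume "\<not> ?g (Max W) \<le> ?g w"
    then have "Suc ?v \<le> ?g (Max W)" "?v \<le> ?g (Max W)" by auto
    moreover have MW: "Max W \<in> W" using W(1) w by (auto intro: Max_in)
    ultimately have M: "Max W \<in> ?P (Suc ?v)" "Max W \<in> ?P ?v" using lev by auto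
    have nb: "b \<notin> ?P ?v" if "Max W < b" for b
      using Max_ge[OF W(1), of b] subsetD[OF PW, of b ?v] that by auto
    have "Max W \<in> ends l (?P ?v)" using M(2) nb[of "Max W + l"] l by (simp add: ends_def)
    moreover have "card {b \<in> ends l (?P ?v). Max W < b} = 0"
    proof -
      have "{b \<in> ends l (?P ?v). Max W < b} = {}" using nb by (auto simp: ends_def)
      then show ?thesis by (simp only: card.empty)
    qed
    \<comment> \<open>Since \<open>w\<close> is removed at this stage, \<open>m ?v\<close> is
      positive; the largest end, which is \<open>Max W\<close>, is then removed as well.\<close>
    ultimately have "Max W \<in> top_part (m ?v) (ends l (?P ?v))"
      using gone[OF w] unfolding top_part_def by simp
    then show False using M(1) by simp
  qed
  show "tail_card {w \<in> W. v \<le> ?g w} t \<le> tail_card {w \<in> W. v \<le> h w} t"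
    if "labelling l W h" "\<And>v. card {w \<in> W. h w = v} = card {w \<in> W. f w = v}" for h v t
    using dom[OF that(1)] that(2) unfolding levS m_def by blast
qed

section \<open>From domination of tail counts to lexicographic order and weighted sums\<close>

lemma dominance_first_difference:
  assumes "finite W" "t \<in> W" "\<And>w. w \<in> W \<Longrightarrow> t < w \<Longrightarrow> g w = h w"
    and dom: "tail_card {w \<in> W. g t \<le> g w} t \<le> tail_card {w \<in> W. g t \<le> h w} t"
  shows "g t \<le> (h t :: nat)"
proof (rule ccontr)
  assume "\<not> g t \<le> h t"
  \<comment> \<open>Beyond \<open>t\<close> both functions agree; at the level \<open>g t\<close>
    the cell \<open>t\<close> itself counts for \<open>g\<close> only.\<close>
  then have "{w \<in> {w \<in> W. g t \<le> h w}. t \<le> w} \<subset> {w \<in> {w \<in> W. g t \<le> g w}. t \<le> w}"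
    using assms by (auto simp: order_le_less)
  then have "tail_card {w \<in> W. g t \<le> h w} t < tail_card {w \<in> W. g t \<le> g w} t"
    unfolding tail_card_def using assms(1) by (intro psubset_card_mono) auto
  then show False using dom by simp
qed

text \<open>Double counting: \<open>w * f w\<close> is the number of pairs \<open>(t, v)\<close> of
  positive numbers with \<open>t\<close> \<le> \<open>w\<close> and \<open>v\<close> \<le>
  \<open>f w\<close>.\<close>

lemma weighted_sum_eq_sum_tail_card:
  assumes "finite W" "\<And>w. w \<in> W \<Longrightarrow> w \<le> T" "\<And>w. w \<in> W \<Longrightarrow> f w \<le> V"
  shows "(\<Sum>w\<in>W. w * f w) = (\<Sum>(t, v)\<in>{1..T} \<times> {1..V}. tail_card {w \<in> W. v \<le> f w} t)"
proof -
  have "(\<Sum>w\<in>W. w * f w) = (\<Sum>w\<in>W. \<Sum>p\<in>{1..T} \<times> {1..V}. of_bool (fst p \<le> w \<and> snd p \<le> f w))"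
  proof (rule sum.cong)
    fix w assume "w \<in> W"
    then have "{p \<in> {1..T} \<times> {1..V}. fst p \<le> w \<and> snd p \<le> f w} = {1..w} \<times> {1..f w}"
      using assms(2,3) by fastforce
    then show "w * f w = (\<Sum>p\<in>{1..T} \<times> {1..V}. of_bool (fst p \<le> w \<and> snd p \<le> f w))"
      by (simp add: Int_def card_cartesian_product flip: Collect_conj_eq)
  qed simp
  also have "\<dots> = (\<Sum>p\<in>{1..T} \<times> {1..V}. \<Sum>w\<in>W. of_bool (fst p \<le> w \<and> snd p \<le> f w))"
    by (rule sum.swap)
  also have "\<dots> = (\<Sum>(t, v)\<in>{1..T} \<times> {1..V}. tail_card {w \<in> W. v \<le> f w} t)"
    unfolding tail_card_def using assms(1)
    by (intro sum.cong refl) (auto simp: Int_def intro!: arg_cong[where f = card])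
  finally show ?thesis .
qed

text \<open>The drop of the tail count from \<open>t\<close> to \<open>Suc t\<close> tells whether
  \<open>t\<close> is an element.\<close>

lemma tail_card_inject:
  assumes "finite X" "finite Y" "\<And>t. tail_card X t = tail_card Y t"
  shows "X = Y"
proof -
  have "tail_card Z t = tail_card Z (Suc t) + of_bool (t \<in> Z)" if "finite Z" for Z t
  proof -
    have "{w \<in> Z. t \<le> w} = {w \<in> Z. Suc t \<le> w} \<union> (if t \<in> Z then {t} else {})"
      by (auto simp: le_less Suc_le_eq)
    then show ?thesis using that by (simp add: tail_card_def)
  qed
  then have "of_bool (t \<in> X) = (of_bool (t \<in> Y) :: nat)" for t using assms by (metis add_left_cancel)
  then show ?thesis by (auto simp: of_bool_eq_iff)
qed

text \<open>Compare the double sums term by term. Equal sums force every term to be equal, hence all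
  level sets, hence the functions.\<close>

lemma dominance_weighted_sum:
  assumes W: "finite W"
    and dom: "\<And>v t. tail_card {w \<in> W. v \<le> g w} t \<le> tail_card {w \<in> W. v \<le> h w} t"
    and tot: "\<And>v. card {w \<in> W. v \<le> g w} = card {w \<in> W. v \<le> h w}"
  shows "(\<Sum>w\<in>W. w * g w) \<le> (\<Sum>w\<in>W. w * h w)"
    and "(\<Sum>w\<in>W. w * g w) = (\<Sum>w\<in>W. w * h w) \<Longrightarrow> w \<in> W \<Longrightarrow> g w = h w"
proof -
  obtain T where T: "\<And>w. w \<in> W \<Longrightarrow> w \<le> T" using W by (meson finite_nat_set_iff_bounded_le)
  obtain V where V: "\<And>w. w \<in> W \<Longrightarrow> g w \<le> V \<and> h w \<le> V"
  proof -
    obtain V1 V2 where "\<And>w. w \<in> W \<Longrightarrow> g w \<le> V1" "\<And>w. w \<in> W \<Longrightarrow> h w \<le> V2"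
      using W by (metis finite_imageI finite_nat_set_iff_bounded_le imageI)
    then show ?thesis using that[of "max V1 V2"] by (auto simp: le_max_iff_disj)
  qed
  have sg: "(\<Sum>w\<in>W. w * g w) = (\<Sum>(t, v)\<in>{1..T} \<times> {1..V}. tail_card {w \<in> W. v \<le> g w} t)"
    and sh: "(\<Sum>w\<in>W. w * h w) = (\<Sum>(t, v)\<in>{1..T} \<times> {1..V}. tail_card {w \<in> W. v \<le> h w} t)"
    using V by (intro weighted_sum_eq_sum_tail_card W T; simp)+
  show "(\<Sum>w\<in>W. w * g w) \<le> (\<Sum>w\<in>W. w * h w)"
    unfolding sg sh by (rule sum_mono) (use dom in auto)
  assume eq: "(\<Sum>w\<in>W. w * g w) = (\<Sum>w\<in>W. w * h w)" and w: "w \<in> W"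
  have "tail_card {w \<in> W. v \<le> g w} t = tail_card {w \<in> W. v \<le> h w} t" for t v
  proof -
    \<comment> \<open>Only the rectangle is covered by the sums. For \<open>t = 0\<close> the total
      sizes agree, for \<open>v = 0\<close> both level sets are \<open>W\<close>, and beyond
      \<open>T\<close> or \<open>V\<close> both counts vanish.\<close>
    consider "t = 0 \<or> v = 0" | "t > T \<or> v > V" | "(t, v) \<in> {1..T} \<times> {1..V}" by fastforce
    then show ?thesis
    proof cases
      case 1
      then show ?thesis using tot by auto
    next
      case 2
      have "\<not> (v \<le> g w \<and> t \<le> w)" "\<not> (v \<le> h w \<and> t \<le> w)" if "w \<in> W" for w
        using 2 T[OF that] V[OF that] by auto
      then have "{w \<in> {w \<in> W. v \<le> g w}. t \<le> w} = {}" "{w \<in> {w \<in> W. v \<le> h w}. t \<le> w} = {}"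
        by blast+
      then show ?thesis by (simp only: tail_card_def)
    next
      case 3
      have "(case (t, v) of (t, v) \<Rightarrow> tail_card {w \<in> W. v \<le> g w} t) =
          (case (t, v) of (t, v) \<Rightarrow> tail_card {w \<in> W. v \<le> h w} t)"
        by (rule sum_mono_inv[OF eq[unfolded sg sh] _ 3]) (simp_all add: dom case_prod_beta)
      then show ?thesis by simp
    qed
  qed
  then have "{w \<in> W. v \<le> g w} = {w \<in> W. v \<le> h w}" for v
    using W by (intro tail_card_inject) auto
  then have "v \<le> g w \<longleftrightarrow> v \<le> h w" for v using w by blast
  then show "g w = h w" by (meson le_refl order_antisym)
qed

section \<open>Symbols as labellings of their cells; entries and the statistic b\<close>

definition cells :: "nat list \<Rightarrow> nat set" where
  "cells s = {w. w div length s < s ! (w mod length s)}"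

definition cell_entry :: "nat list list \<Rightarrow> nat \<Rightarrow> nat" where
  "cell_entry S w = (let row = S ! (w mod length S) in row ! (length row - Suc (w div length S)))"

lemma bij_betw_cells:
  assumes "s \<noteq> []"
  shows "bij_betw (\<lambda>(i, d). length s * d + i) (SIGMA i:{..<length s}. {..<s ! i}) (cells s)"
  by (rule bij_betw_byWitness[where f' = "\<lambda>w. (w mod length s, w div length s)"])
    (use assms in \<open>auto simp: cells_def\<close>)

lemma finite_cells: "s \<noteq> [] \<Longrightarrow> finite (cells s)"
  using bij_betw_finite[OF bij_betw_cells] by simp

lemma sum_cells:
  assumes "s \<noteq> []"
  shows "(\<Sum>w\<in>cells s. f w) = (\<Sum>i<length s. \<Sum>d<s ! i. f (length s * d + i))"
  by (simp add: sum.Sigma sum.reindex_bij_betw[OF bij_betw_cells[OF assms], symmetric] case_prod_beta)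

lemma closed_under_sub_cells: "s \<noteq> [] \<Longrightarrow> closed_under_sub (length s) (cells s)"
  by (auto simp: closed_under_sub_def cells_def)

lemma SymbD:
  assumes "S \<in> Symb s"
  shows "length S = length s" "\<And>i. i < length s \<Longrightarrow> length (S ! i) = s ! i"
    "\<And>i. i < length s \<Longrightarrow> sorted_wrt (<) (S ! i)"
  using assms by (auto simp: Symb_def)

lemma cell_entry_eq:
  assumes "S \<in> Symb s" "i < length s"
  shows "cell_entry S (length s * d + i) = S ! i ! (s ! i - Suc d)"
proof -
  have "s \<noteq> []" using assms(2) by auto
  then show ?thesis using assms SymbD[OF assms(1)] by (simp add: cell_entry_def Let_def)
qed

text \<open>Adding \<open>length s\<close> to a cell number moves one place to the left in the same
  row.\<close>

lemma labelling_cell_entry: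
  assumes "s \<noteq> []" "S \<in> Symb s"
  shows "labelling (length s) (cells s) (cell_entry S)"
  unfolding labelling_def
proof (intro allI impI)
  fix w assume w: "w + length s \<in> cells s"
  let ?l = "length s" let ?i = "w mod ?l" let ?d = "w div ?l"
  have i: "?i < ?l" using assms(1) by simp
  have w1: "w = ?l * ?d + ?i" and w2: "w + ?l = ?l * Suc ?d + ?i" by simp_all
  have d: "Suc ?d < s ! ?i" using w assms(1) by (simp add: cells_def)
  have "cell_entry S (w + ?l) = S ! ?i ! (s ! ?i - Suc (Suc ?d))"
    by (subst w2) (rule cell_entry_eq[OF assms(2) i])
  moreover have "cell_entry S w = S ! ?i ! (s ! ?i - Suc ?d)"
    by (subst w1) (rule cell_entry_eq[OF assms(2) i])
  moreover have "S ! ?i ! (s ! ?i - Suc (Suc ?d)) < S ! ?i ! (s ! ?i - Suc ?d)"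
    by (rule sorted_wrt_nth_less[OF SymbD(3)[OF assms(2) i]])
      (use d SymbD(2)[OF assms(2) i] in auto)
  ultimately show "cell_entry S (w + ?l) < cell_entry S w" by simp
qed

lemma cell_in_cells:
  assumes "i < length s" "d < s ! i" shows "length s * d + i \<in> cells s"
  using assms by (cases "s = []") (simp_all add: cells_def)

lemma cell_entry_inject:
  assumes "S \<in> Symb s" "T \<in> Symb s"
    and eq: "\<And>w. w \<in> cells s \<Longrightarrow> cell_entry S w = cell_entry T w"
  shows "S = T"
proof (rule nth_equalityI)
  show "length S = length T" using SymbD(1) assms by simp
  fix i assume "i < length S"
  then have i: "i < length s" using SymbD(1)[OF assms(1)] by simp
  show "S ! i = T ! i"
  proof (rule nth_equalityI)
    show "length (S ! i) = length (T ! i)" using SymbD(2)[OF _ i] assms by simp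
    fix j assume "j < length (S ! i)"
    then have j: "j < s ! i" using SymbD(2)[OF assms(1) i] by simp
    then have "s ! i - Suc (s ! i - Suc j) = j" by simp
    then show "S ! i ! j = T ! i ! j"
      using eq[OF cell_in_cells[OF i, of "s ! i - Suc j"]] j
        cell_entry_eq[OF assms(1) i, of "s ! i - Suc j"] cell_entry_eq[OF assms(2) i, of "s ! i - Suc j"]
      by simp
  qed
qed

lemma symbol_of_labelling:
  assumes "s \<noteq> []" "labelling (length s) (cells s) g"
  obtains S where "S \<in> Symb s" "\<And>w. w \<in> cells s \<Longrightarrow> cell_entry S w = g w"
proof
  let ?l = "length s"
  \<comment> \<open>List place \<open>j\<close> of row \<open>i\<close> lies at distance
    \<open>s ! i - Suc j\<close> from the right end.\<close>
  define S where "S = map (\<lambda>i. map (\<lambda>j. g (?l * (s ! i - Suc j) + i)) [0..<s ! i]) [0..<?l]"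
  have "sorted_wrt (<) (S ! i)" if i: "i < ?l" for i
    unfolding sorted_wrt_iff_nth_Suc_transp[OF transp_on_less]
  proof (intro allI impI)
    fix j assume "Suc j < length (S ! i)"
    then have j: "Suc j < s ! i" using i by (simp add: S_def)
    \<comment> \<open>\<open>?w\<close> is the cell of list place \<open>Suc j\<close>, and
      \<open>?w + ?l\<close> is the cell of place \<open>j\<close>.\<close>
    let ?w = "?l * (s ! i - Suc (Suc j)) + i"
    have *: "?w + ?l = ?l * (s ! i - Suc j) + i"
      using j by (metis Suc_diff_Suc add.commute add.left_commute mult_Suc_right)
    have "?w + ?l \<in> cells s" unfolding * by (rule cell_in_cells[OF i]) (use j in simp)
    then have "g (?w + ?l) < g ?w" using assms(2) by (simp only: labelling_def)
    then have "g (?l * (s ! i - Suc j) + i) < g ?w" unfolding * .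
    then show "S ! i ! j < S ! i ! Suc j" using i j by (simp add: S_def)
  qed
  moreover have "length S = ?l" by (simp add: S_def)
  ultimately have "\<forall>row\<in>set S. sorted_wrt (<) row" by (auto simp: in_set_conv_nth)
  then show S: "S \<in> Symb s"
    by (simp add: Symb_def) (simp add: S_def comp_def map_nth)
  fix w assume w: "w \<in> cells s"
  let ?i = "w mod ?l" let ?d = "w div ?l"
  have i: "?i < ?l" and d: "?d < s ! ?i" and w1: "w = ?l * ?d + ?i"
    using w assms(1) by (auto simp: cells_def)
  have "cell_entry S w = S ! ?i ! (s ! ?i - Suc ?d)"
    by (subst w1) (rule cell_entry_eq[OF S i])
  also have "\<dots> = g (?l * (s ! ?i - Suc (s ! ?i - Suc ?d)) + ?i)"
    using i d by (simp add: S_def)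
  also have "\<dots> = g w" using d w1 by simp
  finally show "cell_entry S w = g w" .
qed

lemma entries_eq_image_cells:
  assumes "s \<noteq> []" "S \<in> Symb s"
  shows "entries S = image_mset (cell_entry S) (mset_set (cells s))"
proof -
  have row: "mset xs = (\<Sum>d<length xs. {#xs ! (length xs - Suc d)#})" for xs :: "nat list"
  proof -
    have "mset xs = (\<Sum>k<length xs. {#xs ! k#})"
      by (induction xs rule: rev_induct) (simp_all add: nth_append)
    then show ?thesis by (simp add: sum.nat_diff_reindex[where g = "\<lambda>k. {#xs ! k#}"])
  qed
  have "entries S = (\<Sum>i<length s. mset (S ! i))"
    unfolding entries_def using SymbD(1)[OF assms(2)]
    by (simp add: mset_concat sum_list_sum_nth atLeast0LessThan)
  also have "\<dots> = (\<Sum>i<length s. \<Sum>d<s ! i. {#cell_entry S (length s * d + i)#})"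
    using SymbD(2)[OF assms(2)] by (intro sum.cong refl) (simp add: row cell_entry_eq[OF assms(2)])
  also have "\<dots> = (\<Sum>w\<in>cells s. {#cell_entry S w#})"
    by (rule sum_cells[OF assms(1), symmetric])
  also have "\<dots> = image_mset (cell_entry S) (mset_set (cells s))"
    using finite_cells[OF assms(1)] by (induction rule: finite_induct) simp_all
  finally show ?thesis .
qed

text \<open>Translates belonging to the same family into equal numbers of cells for every condition
  on entries.\<close>

lemma card_cells_entries:
  assumes "s \<noteq> []" "S \<in> Symb s"
  shows "card {w \<in> cells s. P (cell_entry S w)} = size (filter_mset P (entries S))"
  using finite_cells[OF assms(1)] unfolding entries_eq_image_cells[OF assms]
  by (simp add: filter_mset_image_mset)

lemma card_cells_entry_eq:
  assumes "s \<noteq> []" "S \<in> Symb s"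
  shows "card {w \<in> cells s. cell_entry S w = v} = count (entries S) v"
  by (simp add: card_cells_entries[OF assms, where P = "\<lambda>x. x = v"] filter_eq_replicate_mset)

text \<open>The first factor in \<open>b_stat\<close> is exactly the cell number. What is subtracted
  from the entry is its place in the row, so the second sum depends on \<open>s\<close>
  only.\<close>

lemma b_stat_eq:
  assumes "s \<noteq> []" "S \<in> Symb s"
  shows "b_stat S = int (\<Sum>w\<in>cells s. w * cell_entry S w) -
    int (\<Sum>w\<in>cells s. w * (s ! (w mod length s) - Suc (w div length s)))"
proof -
  let ?l = "length s"
  have shift: "(\<Sum>k = 1..n. f k) = (\<Sum>k<n. f (Suc k))" for f :: "nat \<Rightarrow> int" and n
    by (simp add: sum.atLeast1_atMost_eq)
  have row: "(\<Sum>j = 1..s ! i. int (?l * (s ! i - j) + Suc i - 1) * (int (S ! i ! (j - 1)) - int j + 1)) =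
    (\<Sum>d<s ! i. int (?l * d + i) * (int (cell_entry S (?l * d + i)) - int (s ! i - Suc d)))"
    (is "sum ?f _ = _") if i: "i < ?l" for i
  proof -
    have "sum ?f {1..s ! i} = (\<Sum>k<s ! i. ?f (Suc k))"
      by (rule shift)
    \<comment> \<open>Passes from places counted from the left to distances \<open>d\<close> from
      the right end.\<close>
    also have "\<dots> = (\<Sum>d<s ! i. ?f (Suc (s ! i - Suc d)))"
      by (rule sum.nat_diff_reindex[symmetric])
    also have "\<dots> = (\<Sum>d<s ! i. int (?l * d + i) * (int (cell_entry S (?l * d + i)) - int (s ! i - Suc d)))"
      by (intro sum.cong refl) (simp add: cell_entry_eq[OF assms(2) i])
    finally show ?thesis .
  qed
  have "b_stat S = (\<Sum>i<?l. \<Sum>j = 1..s ! i.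
      int (?l * (s ! i - j) + Suc i - 1) * (int (S ! i ! (j - 1)) - int j + 1))"
    unfolding b_stat_def SymbD(1)[OF assms(2)]
    by (subst shift) (intro sum.cong refl; simp add: SymbD(2)[OF assms(2)])
  also have "\<dots> = (\<Sum>i<?l. \<Sum>d<s ! i.
      int (?l * d + i) * (int (cell_entry S (?l * d + i)) - int (s ! i - Suc d)))"
    by (intro sum.cong refl row) simp
  also have "\<dots> = (\<Sum>w\<in>cells s. int w * (int (cell_entry S w) - int (s ! (w mod ?l) - Suc (w div ?l))))"
    unfolding sum_cells[OF assms(1)] by (intro sum.cong refl) (use assms(1) in simp)
  finally show ?thesis by (simp add: right_diff_distrib sum_subtractf)
qed

section \<open>The reading order of the display as decreasing cell numbers\<close>

definition cells_list :: "nat list \<Rightarrow> nat list" where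
  "cells_list s = filter (\<lambda>w. w \<in> cells s) (rev [0..<length s * Max (set s)])"

lemma set_cells_list:
  assumes "s \<noteq> []" shows "set (cells_list s) = cells s"
proof -
  have "w < length s * Max (set s)" if "w \<in> cells s" for w
  proof -
    have "s ! (w mod length s) \<le> Max (set s)" using assms by (intro Max_ge) auto
    then have "w div length s < Max (set s)" using that by (simp add: cells_def)
    then show ?thesis using assms by (simp add: div_less_iff_less_mult mult.commute)
  qed
  then show ?thesis by (auto simp: cells_list_def)
qed

lemma sorted_cells_list: "sorted_wrt (>) (cells_list s)"
  unfolding cells_list_def by (intro sorted_wrt_filter) (simp add: sorted_wrt_rev)

lemma distinct_cells_list: "distinct (cells_list s)"
  by (simp add: cells_list_def)

text \<open>With \<open>M\<close> columns, block \<open>c\<close> holds the numbers at distance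
  \<open>M - Suc c\<close> from the right edge, that is column \<open>c\<close>; decreasing order
  inside it reads the rows from bottom to top.\<close>

lemma rev_upt_blocks:
  "rev [0..<l * M] = concat (map (\<lambda>c. rev [l * (M - Suc c)..<l * (M - Suc c) + l]) [0..<M])"
proof (induction M)
  case (Suc M)
  have "[0..<l * Suc M] = [0..<l * M] @ [l * M..<l * M + l]"
    using upt_add_eq_append[of 0 "l * M" l] by (simp add: add.commute)
  moreover have "[0..<Suc M] = 0 # map Suc [0..<M]"
    by (simp add: upt_conv_Cons map_Suc_upt del: upt_Suc)
  ultimately show ?case using Suc by (simp add: comp_def del: upt_Suc)
qed simp

lemma column_eq:
  assumes "s \<noteq> []" "S \<in> Symb s" "c < Max (set s)"
  defines "d \<equiv> Max (set s) - Suc c"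
  shows "column S c = map (cell_entry S)
    (filter (\<lambda>w. w \<in> cells s) (rev [length s * d..<length s * d + length s]))"
proof -
  let ?l = "length s" and ?M = "Max (set s)"
  have set_s: "length ` set S = set s" using assms(2) by (auto simp: Symb_def)
  have M: "num_columns S = ?M" by (simp add: num_columns_def set_s)
  have collect: "concat (map (\<lambda>x. if P x then [f x] else []) xs) = map f (filter P xs)"
    for P and f :: "nat list \<Rightarrow> nat" and xs
    by (induction xs) auto
  have revS: "rev S = map ((!) S) (rev [0..<?l])"
    by (metis SymbD(1)[OF assms(2)] map_nth rev_map)
  have "rev [?l * d..<?l * d + ?l] = map (\<lambda>i. ?l * d + i) (rev [0..<?l])"
    using map_add_upt[of "?l * d" ?l] by (simp add: add.commute flip: rev_map)
  then have "map (cell_entry S) (filter (\<lambda>w. w \<in> cells s) (rev [?l * d..<?l * d + ?l])) =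
      map (\<lambda>i. cell_entry S (?l * d + i)) (filter (\<lambda>i. ?l * d + i \<in> cells s) (rev [0..<?l]))"
    by (simp add: filter_map comp_def)
  also have "\<dots> = map (\<lambda>i. S ! i ! (c - (?M - length (S ! i))))
      (filter (\<lambda>i. ?M - length (S ! i) \<le> c) (rev [0..<?l]))"
  proof (rule map_cong)
    have le: "s ! i \<le> ?M" if "i < ?l" for i using that by simp
    show "filter (\<lambda>i. ?l * d + i \<in> cells s) (rev [0..<?l]) =
        filter (\<lambda>i. ?M - length (S ! i) \<le> c) (rev [0..<?l])"
    proof (rule filter_cong)
      fix i assume "i \<in> set (rev [0..<?l])"
      then have i: "i < ?l" by simp
      \<comment> \<open>Row \<open>i\<close> reaches column \<open>c\<close> exactly when its length
        exceeds \<open>d\<close>, the distance of the column from the right edge.\<close>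
      then show "?l * d + i \<in> cells s \<longleftrightarrow> ?M - length (S ! i) \<le> c"
        using le[OF i] assms(1,3) SymbD(2)[OF assms(2) i] by (auto simp: cells_def d_def)
    qed simp
    fix i assume "i \<in> set (filter (\<lambda>i. ?M - length (S ! i) \<le> c) (rev [0..<?l]))"
    then have i: "i < ?l" "?M - s ! i \<le> c" using SymbD(2)[OF assms(2)] by auto
    then have "c - (?M - s ! i) = s ! i - Suc d"
      using le[OF i(1)] assms(3) by (simp add: d_def)
    then show "cell_entry S (?l * d + i) = S ! i ! (c - (?M - length (S ! i)))"
      using cell_entry_eq[OF assms(2) i(1)] SymbD(2)[OF assms(2) i(1)] by simp
  qed
  finally show ?thesis
    unfolding column_def M collect revS by (simp add: filter_map comp_def)
qed

lemma z_seq_eq: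
  assumes "s \<noteq> []" "S \<in> Symb s"
  shows "z_seq S = map (cell_entry S) (cells_list s)"
proof -
  have "length ` set S = set s" using assms(2) by (auto simp: Symb_def)
  then have M: "num_columns S = Max (set s)" by (simp add: num_columns_def)
  have "map (column S) [0..<Max (set s)] = map (\<lambda>c. map (cell_entry S) (filter (\<lambda>w. w \<in> cells s)
      (rev [length s * (Max (set s) - Suc c)..<length s * (Max (set s) - Suc c) + length s])))
      [0..<Max (set s)]"
    by (intro map_cong refl column_eq[OF assms]) simp
  then show ?thesis
    unfolding z_seq_def M cells_list_def rev_upt_blocks filter_concat map_concat map_map comp_def
    by (rule arg_cong)
qed

section \<open>Identification of the greedy symbol and comparison of \<open>b_stat\<close> on the
  family\<close>

theorem theorem5p2:
  fixes s :: "nat list" and F :: "nat list list set"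
  assumes "length s \<ge> 1"
    and "sorted_wrt (\<ge>) s"
    and "F \<in> families s"
  shows "S_fam F \<in> F \<and>
    (\<forall>S\<in>F. b_stat (S_fam F) \<le> b_stat S \<and> (b_stat (S_fam F) = b_stat S \<longleftrightarrow> S = S_fam F))"
proof -
  have s: "s \<noteq> []" using assms(1) by auto
  obtain S0 where S0: "S0 \<in> Symb s" and F: "F = {T \<in> Symb s. entries T = entries S0}"
    using assms(3) that by (auto simp: families_def quotient_def family_rel_def eq_commute)
  define E where "E = entries S0"
  define W where "W = cells s"
  define L where "L = cells_list s"
  note W = finite_cells[OF s, folded W_def] closed_under_sub_cells[OF s, folded W_def]
  have setL: "set L = W" by (simp add: L_def W_def set_cells_list[OF s])
  obtain g where g: "labelling (length s) W g"
      "\<And>v. card {w \<in> W. g w = v} = card {w \<in> W. cell_entry S0 w = v}"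
      "\<And>w. w \<in> W \<Longrightarrow> g (Max W) \<le> g w"
      "\<And>h v t. labelling (length s) W h \<Longrightarrow>
        (\<And>v. card {w \<in> W. h w = v} = card {w \<in> W. cell_entry S0 w = v}) \<Longrightarrow>
        tail_card {w \<in> W. v \<le> g w} t \<le> tail_card {w \<in> W. v \<le> h w} t"
    using greedy_labelling[OF W, of "cell_entry S0"] labelling_cell_entry[OF s S0] s
    unfolding W_def by auto
  obtain G where G: "G \<in> Symb s" and Gg: "\<And>w. w \<in> W \<Longrightarrow> cell_entry G w = g w"
    using symbol_of_labelling[OF s, of g] g(1) unfolding W_def by metis
  have Gset: "{w \<in> W. P (cell_entry G w)} = {w \<in> W. P (g w)}" for P
    using Gg by auto
  have "count (entries G) v = count (entries S0) v" for v
    using card_cells_entry_eq[OF s G, of v] card_cells_entry_eq[OF s S0, of v] g(2)[of v]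
      Gset[of "\<lambda>x. x = v"] unfolding W_def by simp
  then have GE: "entries G = E" unfolding E_def by (rule multiset_eqI)
  then have GF: "G \<in> F" using G by (simp add: F E_def)
  have dom: "tail_card {w \<in> W. v \<le> cell_entry G w} t \<le> tail_card {w \<in> W. v \<le> cell_entry S w} t"
    if S: "S \<in> F" for S v t
  proof -
    have S': "S \<in> Symb s" "entries S = entries S0" using S by (auto simp: F)
    show ?thesis unfolding Gset unfolding W_def
      by (rule g(4)[unfolded W_def])
        (simp_all add: labelling_cell_entry s S' card_cells_entry_eq[OF s S'(1)] card_cells_entry_eq[OF s S0])
  qed
  have z: "z_seq S = map (cell_entry S) L" if "S \<in> F" for S
    using z_seq_eq[OF s, of S] that by (simp add: F L_def)
  have EG: "E = mset (z_seq G)"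
    unfolding GE[symmetric] entries_eq_image_cells[OF s G] z[OF GF]
    using setL by (simp add: W_def mset_set_set[OF distinct_cells_list[of s], folded L_def, symmetric])
  have famE: "family_entries F = E"
    unfolding family_entries_def
    by (rule the_equality) (use GF GE in \<open>auto simp: F E_def\<close>)
  \<comment> \<open>By induction the greedy choice follows \<open>z_seq G\<close>, as long as cells
    remain to be read.\<close>
  have prefix: "greedy_prefix F i = take i (z_seq G)" if "i \<le> length L" for i
    using that
  proof (induction i)
    case (Suc i)
    then have i: "i < length L" and IH: "greedy_prefix F i = take i (z_seq G)" by auto
    have lenz: "length (z_seq G) = length L" using z[OF GF] by simp
    have next_entry: "z_seq G ! i = (if i = 0 then Min (set_mset E)
      else LEAST x. x \<in># E - mset (take i (z_seq G)) \<and> (\<exists>S\<in>F. prefix (take i (z_seq G) @ [x]) (z_seq S)))"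
    proof (cases "i = 0")
      case True
      \<comment> \<open>The first term is the minimum of \<open>E\<close> with no realisability
        condition, so \<open>g\<close> must be smallest at the cell read first.\<close>
      have "L ! 0 = Max W"
      proof (rule Max_eqI[symmetric])
        show "L ! 0 \<in> W" using i True setL nth_mem by blast
        fix w assume "w \<in> W"
        then obtain k where "k < length L" "w = L ! k" using setL by (metis in_set_conv_nth)
        then show "w \<le> L ! 0"
          using sorted_wrt_nth_less[OF sorted_cells_list[of s], of 0 k] unfolding L_def
          by (cases "k = 0") auto
      qed (rule W(1))
      moreover have "Max W \<in> W" using W(1) i setL by (intro Max_in) auto
      ultimately have "Min (set_mset E) = z_seq G ! 0"
        using i True Gg g(3) setL unfolding EG z[OF GF] by (intro Min_eqI) auto
      then show ?thesis using True by simp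
    next
      case False
      have "(LEAST x. x \<in># E - mset (take i (z_seq G)) \<and>
          (\<exists>S\<in>F. prefix (take i (z_seq G) @ [x]) (z_seq S))) = z_seq G ! i"
      proof (rule Least_equality)
        have "z_seq G = take i (z_seq G) @ z_seq G ! i # drop (Suc i) (z_seq G)"
          using i lenz by (simp add: id_take_nth_drop)
        then have "E - mset (take i (z_seq G)) = mset (z_seq G ! i # drop (Suc i) (z_seq G))"
          unfolding EG by (metis add_diff_cancel_left' mset_append)
        moreover have "prefix (take i (z_seq G) @ [z_seq G ! i]) (z_seq G)"
          using i lenz by (metis take_Suc_conv_app_nth take_is_prefix)
        ultimately show "z_seq G ! i \<in># E - mset (take i (z_seq G)) \<and>
            (\<exists>S\<in>F. prefix (take i (z_seq G) @ [z_seq G ! i]) (z_seq S))"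
          using GF by auto
      next
        fix x
        assume "x \<in># E - mset (take i (z_seq G)) \<and> (\<exists>S\<in>F. prefix (take i (z_seq G) @ [x]) (z_seq S))"
        then obtain S r where S: "S \<in> F" and r: "z_seq S = (take i (z_seq G) @ [x]) @ r"
          by (auto simp: prefix_def)
        have len: "length (take i (z_seq G)) = i" using i lenz by simp
        have x: "z_seq S ! i = x" using r len by (simp add: nth_append)
        have eq: "z_seq S ! j = z_seq G ! j" if "j < i" for j
          using r len that by (simp add: nth_append)
        \<comment> \<open>The cells with number above \<open>L ! i\<close> are those read earlier,
          where \<open>S\<close> agrees with \<open>G\<close>; domination then settles the first
          possible difference.\<close>
        have "cell_entry G (L ! i) \<le> cell_entry S (L ! i)"
        proof (rule dominance_first_difference[OF W(1) _ _ dom[OF S]])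
          show "L ! i \<in> W" using i setL by auto
          fix w assume "w \<in> W" "L ! i < w"
          then obtain k where k: "k < length L" "w = L ! k" using setL by (metis in_set_conv_nth)
          have "k < i"
            using sorted_wrt_nth_less[OF sorted_cells_list[of s], of i k] k \<open>L ! i < w\<close>
            unfolding L_def by (cases i k rule: linorder_cases) auto
          then show "cell_entry G w = cell_entry S w"
            using eq[of k] k z[OF S] z[OF GF] by simp
        qed
        then show "z_seq G ! i \<le> x" using i x z[OF S] z[OF GF] by simp
      qed
      then show ?thesis using False by simp
    qed
    show ?case
      unfolding greedy_prefix.simps IH famE next_entry[symmetric]
      using i lenz by (simp add: take_Suc_conv_app_nth)
  qed simp
  have "size E = length L" using EG z[OF GF] by simp
  then have full: "greedy_prefix F (size (family_entries F)) = z_seq G"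
    using prefix[of "length L"] z[OF GF] famE by simp
  have uniq: "S = G" if "S \<in> F" "\<And>w. w \<in> W \<Longrightarrow> cell_entry G w = cell_entry S w" for S
    by (rule cell_entry_inject[of _ s]) (use that G in \<open>auto simp: F W_def\<close>)
  have "S_fam F = G"
    unfolding S_fam_def full
  proof (rule the_equality)
    fix S assume S: "S \<in> F \<and> z_seq S = z_seq G"
    \<comment> \<open>\<open>L\<close> runs through all cells, so equal sequences give equal entries
      everywhere.\<close>
    then show "S = G" using z[of S] z[OF GF] setL by (intro uniq) auto
  qed (use GF in simp)
  moreover have "b_stat G \<le> b_stat S \<and> (b_stat G = b_stat S \<longleftrightarrow> S = G)" if S: "S \<in> F" for S
  proof -
    have S': "S \<in> Symb s" "entries S = entries G" using S GE by (auto simp: F E_def)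
    have tot: "card {w \<in> W. v \<le> cell_entry G w} = card {w \<in> W. v \<le> cell_entry S w}" for v
      unfolding W_def by (simp add: card_cells_entries[OF s] G S')
    note ws = dominance_weighted_sum[OF W(1) dom[OF S] tot]
    \<comment> \<open>Both values of \<open>b_stat\<close> differ from the weighted sums by the same
      constant, so order and equality carry over.\<close>
    show ?thesis
      using ws(1) ws(2) uniq[OF S] unfolding b_stat_eq[OF s G] b_stat_eq[OF s S'(1)] W_def[symmetric]
      by (auto simp del: of_nat_sum)
  qed
  ultimately show ?thesis using GF by simp
qed

end
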